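(* For every dimension of the form $d=2^n-1$ with $n$ a positive integer, \[ \operatorname{mv}(d) \ge \frac{(d+1)^{(d+3)/2}}{4^d}. \]
   Context: A lattice $\Lambda\subset\mathbb{R}^d$ is a discrete subgroup of rank $d$. A $d$-dimensional simplex $L=\operatorname{conv}\{v_0,\dots,v_d\}$ with $v_i\in\Lambda$ is a Delone simplex of $\Lambda$ if there exist a center $c\in\mathbb{R}^d$ and a radius $r>0$ with $\|v_i-c\|=r$ for $i=0,\dots,d$ and $\|v-c\|>r$ for all other $v\in\Lambda\setminus\{v_0,\dots,v_d\}$ (Euclidean norm). The relative volume of a lattice simplex $L$ with vertices in $\Lambda$ is $\operatorname{vol}(L)\cdot d!/\det(\Lambda)$, equivalently the index in $\Lambda$ of the lattice affinely generated by the vertices of $L$. $\operatorname{mv}(d)$ denotes the maximum relative volume of a $d$-dimensional Delone simplex, the maximum taken over all lattices $\Lambda\subset\mathbb{R}^d$ and all Delone simplices of $\Lambda$. *)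

theory Defs
  imports "HOL-Analysis.Analysis"
begin

(* The rank of a discrete subgroup is the dimension of its real span. *)
definition euclidean_lattice :: "(real^'d::finite) set \<Rightarrow> bool" where
  "euclidean_lattice \<Lambda> \<longleftrightarrow>
     0 \<in> \<Lambda> \<and> (\<forall>x\<in>\<Lambda>. \<forall>y\<in>\<Lambda>. x - y \<in> \<Lambda>) \<and> discrete \<Lambda> \<and> dim \<Lambda> = CARD('d)"

(* The columns of B form a basis of \<Lambda> as an abelian group. *)
definition lattice_basis :: "(real^'d::finite) set \<Rightarrow> real^'d^'d \<Rightarrow> bool" where
  "lattice_basis \<Lambda> B \<longleftrightarrow> invertible B \<and> \<Lambda> = {B *v z | z. \<forall>i. z $ i \<in> \<int>}"

(* Every lattice has a basis, and any two differ by an integer matrix of determinant 1 or -1. *)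
definition lattice_det :: "(real^'d::finite) set \<Rightarrow> real" where
  "lattice_det \<Lambda> = (THE \<delta>. \<exists>B. lattice_basis \<Lambda> B \<and> \<delta> = \<bar>det B\<bar>)"

definition delone_simplex :: "(real^'d::finite) set \<Rightarrow> (real^'d) set \<Rightarrow> bool" where
  "delone_simplex \<Lambda> L \<longleftrightarrow>
     (\<exists>V. V \<subseteq> \<Lambda> \<and> \<not> affine_dependent V \<and> card V = CARD('d) + 1 \<and> L = convex hull V \<and>
        (\<exists>c r. r > 0 \<and> (\<forall>v\<in>V. norm (v - c) = r) \<and> (\<forall>v\<in>\<Lambda> - V. norm (v - c) > r)))"

definition relative_volume :: "(real^'d::finite) set \<Rightarrow> (real^'d) set \<Rightarrow> real" where
  "relative_volume \<Lambda> L = measure lborel L * fact CARD('d) / lattice_det \<Lambda>"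

(* The type argument serves only to fix the dimension d = CARD('d). The set is finite, so that Max
   is a true maximum: its members are integers, and for fixed d they are bounded (by d!). *)
definition mv :: "'d::finite itself \<Rightarrow> real" where
  "mv _ = Max {relative_volume \<Lambda> L | \<Lambda> (L :: (real^'d) set).
                 euclidean_lattice \<Lambda> \<and> delone_simplex \<Lambda> L}"

end

theory Submission
  imports Defs
begin

text \<open>
  Let \<open>C \<subseteq> {0,1}\<^sup>d\<close> be the binary simplex code and \<open>\<Lambda>\<close> the lattice of integer vectors that reduce
  to \<open>C\<close> modulo 2. The integer points of the closed ball around the cube \<open>[0,1]\<^sup>d\<close> are the cube's
  vertices, and those in \<open>\<Lambda>\<close> are the \<open>d + 1\<close> words of \<open>C\<close>; so \<open>conv C\<close> is a Delone simplex. It is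
  regular of volume \<open>(d+1)\<^bsup>(d+1)/2\<^esup> / (2\<^sup>d d!)\<close> (a Hadamard determinant), and \<open>det \<Lambda> = 2\<^sup>d / (d+1)\<close>.

  That the maximum defining \<open>mv\<close> is taken over a finite set rests on a packing argument.
  If \<open>w \<in> \<Lambda>\<close> and \<open>v\<close> is a vertex of a Delone simplex with centre \<open>c\<close>, then \<open>v + w\<close> and \<open>v - w\<close> are
  outside the open ball, hence \<open>2 \<bar>w \<bullet> (v - c)\<bar> \<le> w \<bullet> w\<close>. Expanding \<open>w\<close> in the edge vectors at one vertex,
  with coefficients of absolute value at most \<open>1 / (d+1)\<close>, forces \<open>w = 0\<close>. So the
  parallelepiped spanned by the edges, shrunk by \<open>d + 1\<close>, packs under \<open>\<Lambda>\<close>, and the relative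
  volume, an integer, is at most \<open>(d+1)\<^sup>d\<close>.
\<close>

section \<open>Volumes under linear maps\<close>

text \<open>
  The library relates determinants to volumes only for index types of class \<open>wellorder\<close>.
  Each finite type is in bijection with such a type, namely a copy of itself ordered by an
  arbitrary injection into the natural numbers.
\<close>

typedef 'a indexed = "UNIV :: 'a set" ..

instance indexed :: (finite) finite
proof
  show "finite (UNIV :: 'a indexed set)"
    using surjI[of Abs_indexed Rep_indexed, OF Rep_indexed_inverse]
    by (metis finite finite_imageI)
qed

instantiation indexed :: (finite) wellorder
begin

definition less_eq_indexed :: "'a indexed \<Rightarrow> 'a indexed \<Rightarrow> bool" where
  "x \<le> y \<longleftrightarrow> (SOME f :: 'a indexed \<Rightarrow> nat. inj f) x \<le> (SOME f :: 'a indexed \<Rightarrow> nat. inj f) y"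

definition less_indexed :: "'a indexed \<Rightarrow> 'a indexed \<Rightarrow> bool" where
  "x < y \<longleftrightarrow> (SOME f :: 'a indexed \<Rightarrow> nat. inj f) x < (SOME f :: 'a indexed \<Rightarrow> nat. inj f) y"

instance
proof
  define f where "f = (SOME f :: 'a indexed \<Rightarrow> nat. inj f)"
  have "\<exists>f :: 'a indexed \<Rightarrow> nat. inj f"
    using finite_imp_inj_to_nat_seg[of "UNIV :: 'a indexed set"] by auto
  then have f: "inj f"
    unfolding f_def by (rule someI_ex)
  note defs = less_eq_indexed_def less_indexed_def f_def[symmetric]
  fix x y z :: "'a indexed"
  show "x < y \<longleftrightarrow> x \<le> y \<and> \<not> y \<le> x" "x \<le> x" "x \<le> y \<or> y \<le> x"
    "x \<le> y \<Longrightarrow> y \<le> z \<Longrightarrow> x \<le> z"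
    unfolding defs by auto
  show "x \<le> y \<Longrightarrow> y \<le> x \<Longrightarrow> x = y"
    unfolding defs using f by (simp add: inj_eq)
  show "P a" if "\<And>x. (\<And>y. y < x \<Longrightarrow> P y) \<Longrightarrow> P x" for P and a :: "'a indexed"
  proof (induction a rule: measure_induct_rule[of f])
    case (less x)
    then show ?case
      using that unfolding defs by blast
  qed
qed

end

lemma bij_Rep_indexed: "bij Rep_indexed"
  by (metis Abs_indexed_inverse Rep_indexed_inverse UNIV_I bij_iff)

text \<open>Conjugation by \<open>f\<close> turns the transposition of \<open>a\<close> and
  \<open>b\<close> into that of \<open>f a\<close> and \<open>f b\<close>, so a factorisation into
  transpositions is carried over factor by factor, even to another index type.\<close>

lemma swapidseq_conj:
  assumes "bij f" "swapidseq k p"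
  shows "swapidseq k (f \<circ> p \<circ> inv f)"
  using assms(2)
proof (induction)
  case id
  then show ?case
    using assms(1) by (metis bij_is_surj comp_id surj_iff swapidseq.id)
next
  case (comp_Suc k p a b)
  have "f \<circ> (Transposition.transpose a b \<circ> p) \<circ> inv f =
      Transposition.transpose (f a) (f b) \<circ> (f \<circ> p \<circ> inv f)"
    using assms(1) by (auto simp: fun_eq_iff Transposition.transpose_def bij_is_inj inj_eq)
  moreover have "f a \<noteq> f b"
    using comp_Suc assms(1) by (simp add: bij_is_inj inj_eq)
  ultimately show ?case
    using comp_Suc.IH by (metis swapidseq.comp_Suc)
qed

lemma sign_conj:
  fixes f :: "'n::finite \<Rightarrow> 'm::finite"
  assumes "bij f" "p permutes UNIV"
  shows "sign (f \<circ> p \<circ> inv f) = sign p"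
proof -
  obtain k where k: "swapidseq k p"
    using assms(2) permutation_def permutation_permutes finite by blast
  show ?thesis
    unfolding sign_def
    using evenperm_unique[OF k refl] evenperm_unique[OF swapidseq_conj[OF assms(1) k] refl] by simp
qed

text \<open>Conjugation by \<open>f\<close> matches the permutations of the two index types, keeps
  their signs, and only reorders the factors in each term of the Leibniz sum.\<close>

lemma det_reindex:
  fixes A :: "'a::comm_ring_1^'m^'m" and f :: "'n::finite \<Rightarrow> 'm::finite"
  assumes f: "bij f"
  shows "det (\<chi> i j. A $ f i $ f j) = det A"
proof -
  have [simp]: "f (inv f x) = x" "inv f (f y) = y" for x y
    using f by (simp_all add: bij_is_surj surj_f_inv_f bij_is_inj)
  have "(\<Prod>i\<in>UNIV. A $ f i $ f (p i)) = (\<Prod>i\<in>UNIV. A $ i $ (f \<circ> p \<circ> inv f) i)" for p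
    using prod.reindex_bij_betw[OF f, of "\<lambda>i. A $ i $ f (p (inv f i))"] by simp
  then show ?thesis
    unfolding det_def
    by (intro sum.reindex_bij_witness[of _ "\<lambda>p. inv f \<circ> p \<circ> f" "\<lambda>p. f \<circ> p \<circ> inv f"])
      (use f in \<open>auto simp: fun_eq_iff sign_conj intro!: bij_imp_permutes bij_comp
         bij_imp_bij_inv dest: permutes_bij\<close>)
qed

lemma linear_reindex: "linear (\<lambda>x :: real^'m. \<chi> i. x $ f i)"
  by (intro linearI) (auto simp: vec_eq_iff)

text \<open>Lebesgue measure is determined by its values on boxes, and relabelling coordinates only
  permutes the side lengths.\<close>

lemma lborel_reindex:
  fixes f :: "'n::finite \<Rightarrow> 'm::finite"
  assumes f: "bij f"
  shows "lborel = distr lborel borel (\<lambda>x :: real^'m. \<chi> i. x $ f i)"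
proof (rule lborel_eqI)
  let ?R = "\<lambda>x :: real^'m. \<chi> i. x $ f i"
  let ?T = "\<lambda>x :: real^'n. \<chi> i. x $ inv f i"
  have [simp]: "f (inv f x) = x" "inv f (f y) = y" for x y
    using f by (simp_all add: bij_is_surj surj_f_inv_f bij_is_inj)
  have [measurable]: "?R \<in> borel \<rightarrow>\<^sub>M borel"
    by (intro borel_measurable_continuous_onI linear_continuous_on
        linear_linear[THEN iffD2] linear_reindex)
  fix l u :: "real^'n"
  assume lu: "\<And>b. b \<in> Basis \<Longrightarrow> l \<bullet> b \<le> u \<bullet> b"
  have le: "l $ i \<le> u $ i" for i
    using lu[of "axis i 1"] by (auto simp: inner_axis)
  have *: "emeasure lborel (box (l :: real^'k::finite) u) = (\<Prod>i\<in>UNIV. u $ i - l $ i)"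
    if "\<And>i. l $ i \<le> u $ i" for l u
  proof -
    have "emeasure lborel (box l u) = (\<Prod>b\<in>Basis. (u - l) \<bullet> b)"
      using that by (subst emeasure_lborel_box) (auto simp: Basis_vec_def inner_axis)
    also have "(\<Prod>b\<in>Basis. (u - l) \<bullet> b) = (\<Prod>i\<in>UNIV. u $ i - l $ i)"
      by (rule prod.reindex_cong[of "\<lambda>i. axis i 1"])
        (auto simp: Basis_vec_def inner_axis inj_on_def axis_eq_axis)
    finally show ?thesis .
  qed
  have "emeasure (distr lborel borel ?R) (box l u) = emeasure lborel (?R -` box l u)"
    by (simp add: emeasure_distr)
  also have "?R -` box l u = box (?T l) (?T u)"
    by (auto simp: box_def Basis_vec_def inner_axis) (metis \<open>\<And>x. f (inv f x) = x\<close> \<open>\<And>y. inv f (f y) = y\<close>)+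
  also have "emeasure lborel \<dots> = (\<Prod>i\<in>UNIV. u $ inv f i - l $ inv f i)"
    using le by (subst *) auto
  also have "(\<Prod>i\<in>UNIV. u $ inv f i - l $ inv f i) = (\<Prod>i\<in>UNIV. u $ i - l $ i)"
    using prod.reindex_bij_betw[OF f, of "\<lambda>i. u $ inv f i - l $ inv f i"] by simp
  also have "(\<Prod>i\<in>UNIV. u $ i - l $ i) = (\<Prod>b\<in>Basis. (u - l) \<bullet> b)"
    by (rule prod.reindex_cong[of "\<lambda>i. axis i 1", symmetric])
      (auto simp: Basis_vec_def inner_axis inj_on_def axis_eq_axis)
  finally show "emeasure (distr lborel borel ?R) (box l u) = (\<Prod>b\<in>Basis. (u - l) \<bullet> b)" .
qed simp

lemma measure_reindex:
  fixes f :: "'n::finite \<Rightarrow> 'm::finite"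
  assumes f: "bij f" and S: "compact S"
  shows "measure lborel ((\<lambda>x :: real^'m. \<chi> i. x $ f i) ` S) = measure lborel S"
proof -
  let ?R = "\<lambda>x :: real^'m. (\<chi> i. x $ f i) :: real^'n"
  have cont: "continuous_on A ?R" for A
    by (intro linear_continuous_on linear_linear[THEN iffD2] linear_reindex)
  have [measurable]: "?R \<in> borel \<rightarrow>\<^sub>M borel"
    by (intro borel_measurable_continuous_onI cont)
  have inj: "inj ?R"
    using f by (auto simp: inj_on_def vec_eq_iff) (metis bij_pointE)
  have "compact (?R ` S)"
    using S cont by (intro compact_continuous_image)
  then have [measurable]: "?R ` S \<in> sets borel"
    by (simp add: borel_compact)
  have "measure lborel (?R ` S) = measure (distr lborel borel ?R) (?R ` S)"
    by (simp add: lborel_reindex[OF f, symmetric])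
  also have "\<dots> = measure lborel (?R -` ?R ` S)"
    by (simp add: measure_distr)
  finally show ?thesis
    using inj by (simp add: inj_vimage_image_eq)
qed

text \<open>Relabelling along \<open>Rep_indexed\<close> conjugates \<open>A\<close> to a matrix
  over a wellordered index type, where \<open>measure_linear_image\<close> applies; the determinant
  and the volumes are unchanged.\<close>

lemma measure_matrix_image:
  fixes A :: "real^'d::finite^'d"
  assumes S: "compact S"
  shows "measure lborel ((*v) A ` S) = \<bar>det A\<bar> * measure lborel S"
proof -
  let ?f = "Rep_indexed :: 'd indexed \<Rightarrow> 'd"
  let ?R = "\<lambda>x :: real^'d. (\<chi> i. x $ ?f i) :: real^'d indexed"
  let ?A = "(\<chi> i j. A $ ?f i $ ?f j) :: real^'d indexed^'d indexed"
  have leb: "measure lebesgue T = measure lborel T" if "compact T" for T :: "(real^'k::finite) set"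
    using that by (simp add: borel_compact)
  have cont: "continuous_on T ?R" for T
    by (intro linear_continuous_on linear_linear[THEN iffD2] linear_reindex)
  have RS: "compact (?R ` S)"
    using S cont by (intro compact_continuous_image)
  have AS: "compact ((*v) B ` T)" if "compact T" for B :: "real^'k::finite^'k" and T
    using that by (intro compact_continuous_image linear_continuous_on linear_linear[THEN iffD2]) auto
  have comm: "?R (A *v x) = ?A *v ?R x" for x
    using sum.reindex_bij_betw[OF bij_Rep_indexed, of "\<lambda>j. A $ _ $ j * x $ j"]
    by (simp add: matrix_vector_mult_def vec_eq_iff)
  have "measure lborel ((*v) A ` S) = measure lborel (?R ` (*v) A ` S)"
    by (intro measure_reindex[symmetric] bij_Rep_indexed AS S)
  also have "?R ` (*v) A ` S = (*v) ?A ` ?R ` S"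
    by (simp only: image_image comm)
  also have "measure lborel \<dots> = measure lebesgue ((*v) ?A ` ?R ` S)"
    by (simp only: leb AS RS)
  also have "\<dots> = \<bar>det ?A\<bar> * measure lebesgue (?R ` S)"
    using measure_linear_image[of "(*v) ?A" "?R ` S"] RS by (simp add: lmeasurable_compact)
  also have "\<dots> = \<bar>det A\<bar> * measure lborel S"
    using det_reindex[OF bij_Rep_indexed, of A] measure_reindex[OF bij_Rep_indexed S]
    by (simp add: leb RS)
  finally show ?thesis .
qed

text \<open>An affine map with linear part \<open>M\<close> carries the standard simplex, of volume
  \<open>1 / fact CARD('d)\<close>, to this one.\<close>

lemma measure_simplex:
  fixes M :: "real^'d::finite^'d"
  shows "measure lborel (convex hull (insert a ((\<lambda>i. a + column i M) ` UNIV))) =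
      \<bar>det M\<bar> / fact CARD('d)"
proof -
  let ?S = "convex hull (insert 0 Basis) :: (real^'d) set"
  have S: "compact ?S"
    by (intro finite_imp_compact_convex_hull) auto
  have MS: "compact ((*v) M ` ?S)"
    using S by (intro compact_continuous_image linear_continuous_on linear_linear[THEN iffD2]) auto
  have eq: "insert a ((\<lambda>i. a + column i M) ` UNIV) = (+) a ` (*v) M ` insert 0 Basis"
    by (auto simp: Basis_vec_def image_iff matrix_vector_mult_basis)
  have hull: "convex hull (insert a ((\<lambda>i. a + column i M) ` UNIV)) = (+) a ` (*v) M ` ?S"
    unfolding eq by (simp only: convex_hull_translation convex_hull_linear_image matrix_vector_mul_linear)
  have "measure lborel (convex hull (insert a ((\<lambda>i. a + column i M) ` UNIV))) =
      measure lebesgue ((+) a ` (*v) M ` ?S)"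
    using MS unfolding hull
    by (intro measure_completion[symmetric]) (auto intro: borel_compact compact_translation)
  also have "\<dots> = measure lborel ((*v) M ` ?S)"
    using MS by (simp add: measure_translation borel_compact)
  also have "\<dots> = \<bar>det M\<bar> / fact CARD('d)"
    using measure_matrix_image[OF S] by (simp add: content_std_simplex)
  finally show ?thesis .
qed

section \<open>Packings and lattice bases\<close>

text \<open>Cut \<open>S\<close> along the integer grid and translate each piece into the unit cube:
  the packing hypothesis keeps the translated pieces disjoint, so their total volume is at most
  1.\<close>

lemma integer_packing_measure_le:
  fixes S :: "(real^'d::finite) set"
  assumes S: "compact S"
    and packing: "\<And>x y. x \<in> S \<Longrightarrow> y \<in> S \<Longrightarrow> (\<And>i. x $ i - y $ i \<in> \<int>) \<Longrightarrow> x = y"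
  shows "measure lborel S \<le> 1"
proof -
  define fl where "fl = (\<lambda>x :: real^'d. \<chi> i. real_of_int \<lfloor>x $ i\<rfloor>)"
  define F where "F = (\<lambda>z. S \<inter> {x. fl x = z})"
  have fl_int: "fl x $ i \<in> \<int>" for x i
    by (simp add: fl_def)
  have fl_le: "fl x $ i \<le> x $ i" "x $ i \<le> fl x $ i + 1" for x i
    by (simp_all add: fl_def)
  obtain b where b: "\<And>x. x \<in> S \<Longrightarrow> norm x \<le> b"
    using compact_imp_bounded[OF S] by (auto simp: bounded_iff)
  \<comment> \<open>A bounded set meets only finitely many grid cells.\<close>
  have "fl ` S \<subseteq> vec_lambda ` PiE UNIV (\<lambda>_ :: 'd. real_of_int ` {\<lfloor>-b\<rfloor>..\<lfloor>b\<rfloor>})"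
  proof
    fix z assume "z \<in> fl ` S"
    then obtain x where x: "x \<in> S" "z = fl x" by auto
    have "-b \<le> x $ i" "x $ i \<le> b" for i
      using component_le_norm_cart[of x i] b[OF x(1)] by auto
    then have "\<lfloor>x $ i\<rfloor> \<in> {\<lfloor>-b\<rfloor>..\<lfloor>b\<rfloor>}" for i
      by (simp add: floor_mono)
    then show "z \<in> vec_lambda ` PiE UNIV (\<lambda>_ :: 'd. real_of_int ` {\<lfloor>-b\<rfloor>..\<lfloor>b\<rfloor>})"
      unfolding x(2) fl_def by (intro imageI) auto
  qed
  then have fin: "finite (fl ` S)"
    by (rule finite_subset) (intro finite_imageI finite_PiE; simp)
  have meas: "F z \<in> lmeasurable" if z_in: "z \<in> fl ` S" for z
  proof -
    have "fl x = z \<longleftrightarrow> (\<forall>i. z $ i \<le> x $ i \<and> x $ i < z $ i + 1)" for x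
    proof -
      obtain y where "z = fl y" using z_in by auto
      then have z: "z $ i = of_int \<lfloor>y $ i\<rfloor>" for i by (simp add: fl_def)
      show ?thesis
        by (simp add: vec_eq_iff fl_def z floor_eq_iff)
    qed
    \<comment> \<open>A grid cell is a half-open cube, measurable as the intersection of a closed
      and an open set.\<close>
    then have eq: "{x. fl x = z} = (\<Inter>i. {x. z $ i \<le> x $ i}) \<inter> (\<Inter>i. {x. x $ i < z $ i + 1})"
      by auto
    have "closed (\<Inter>i. {x. z $ i \<le> x $ i})"
      by (intro closed_INT ballI closed_Collect_le continuous_intros)
    moreover have "open (\<Inter>i. {x. x $ i < z $ i + 1})"
      by (intro open_INT ballI open_Collect_less continuous_intros) auto
    ultimately have "{x. fl x = z} \<in> sets lebesgue"
      unfolding eq by (intro sets.Int) (auto intro: borel_closed borel_open)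
    then show ?thesis
      unfolding F_def using S lmeasurable_compact by (intro fmeasurable_Int_fmeasurable) auto
  qed
  have "measure lborel S = measure lebesgue (\<Union>z\<in>fl ` S. F z)"
  proof -
    have "(\<Union>z\<in>fl ` S. F z) = S"
      by (auto simp: F_def)
    then show ?thesis
      using S by (simp add: borel_compact)
  qed
  also have "\<dots> = (\<Sum>z\<in>fl ` S. measure lebesgue (F z))"
    by (intro measure_UNION' fin meas) (auto simp: pairwise_def disjnt_def F_def)
  also have "\<dots> = (\<Sum>z\<in>fl ` S. measure lebesgue ((\<lambda>x. x - z) ` F z))"
    by (simp only: measure_translation_subtract)
  also have "\<dots> = measure lebesgue (\<Union>z\<in>fl ` S. (\<lambda>x. x - z) ` F z)"
  proof (intro measure_UNION'[symmetric] fin measurable_translation_subtract meas)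
    show "pairwise (\<lambda>z w. disjnt ((\<lambda>x. x - z) ` F z) ((\<lambda>x. x - w) ` F w)) (fl ` S)"
    proof (clarsimp simp: pairwise_def disjnt_iff)
      fix x y u v assume "fl x \<noteq> fl y" and u: "u \<in> F (fl x)" and v: "v \<in> F (fl y)"
        and eq: "u - fl x = v - fl y"
      have "u $ i - v $ i = fl x $ i - fl y $ i" for i
        using arg_cong[OF eq, of "\<lambda>a. a $ i"] by simp
      then have "u $ i - v $ i \<in> \<int>" for i
        using fl_int by simp
      then have "u = v"
        using packing u v by (auto simp: F_def)
      with u v \<open>fl x \<noteq> fl y\<close> show False
        by (simp add: F_def)
    qed
  qed
  also have "\<dots> \<le> measure lebesgue (cbox 0 (1 :: real^'d))"
  proof (rule measure_mono_fmeasurable)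
    show "(\<Union>z\<in>fl ` S. (\<lambda>x. x - z) ` F z) \<subseteq> cbox 0 1"
      by (auto simp: F_def mem_box_cart algebra_simps) (metis fl_le add.commute)+
    show "(\<Union>z\<in>fl ` S. (\<lambda>x. x - z) ` F z) \<in> sets lebesgue"
      by (intro sets.finite_UN fin fmeasurableD measurable_translation_subtract meas)
  qed auto
  also have "\<dots> = 1"
    using content_cbox_cart[of 0 "1 :: real^'d"] by (simp add: interval_ne_empty_cart)
  finally show ?thesis .
qed

text \<open>The inverse of \<open>B\<close> carries the lattice to the integer lattice and divides
  volumes by \<open>\<bar>det B\<bar>\<close>.\<close>

lemma lattice_packing_measure_le:
  fixes S :: "(real^'d::finite) set"
  assumes B: "invertible B" and S: "compact S"
    and packing: "\<And>x y z. x \<in> S \<Longrightarrow> y \<in> S \<Longrightarrow> (\<And>i. z $ i \<in> \<int>) \<Longrightarrow> x - y = B *v z \<Longrightarrow> x = y"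
  shows "measure lborel S \<le> \<bar>det B\<bar>"
proof -
  obtain C where C: "B ** C = mat 1" "C ** B = mat 1"
    using B by (auto simp: invertible_def)
  have BC: "B *v (C *v x) = x" for x
    by (simp add: matrix_vector_mul_assoc C)
  have det: "det B * det C = 1"
    by (metis C(1) det_I det_mul)
  have "measure lborel ((*v) C ` S) \<le> 1"
  proof (rule integer_packing_measure_le)
    show "compact ((*v) C ` S)"
      using S by (intro compact_continuous_image linear_continuous_on linear_linear[THEN iffD2]) auto
    fix x y assume "x \<in> (*v) C ` S" "y \<in> (*v) C ` S" and int: "\<And>i. x $ i - y $ i \<in> \<int>"
    then obtain u v where uv: "u \<in> S" "v \<in> S" "x = C *v u" "y = C *v v" by auto
    then have "u - v = B *v (x - y)"
      by (simp add: matrix_vector_mult_diff_distrib BC)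
    then have "u = v"
      using packing[of u v "x - y"] uv(1,2) int by simp
    then show "x = y"
      using uv by simp
  qed
  then have "\<bar>det B\<bar> * (\<bar>det C\<bar> * measure lborel S) \<le> \<bar>det B\<bar> * 1"
    by (intro mult_left_mono) (simp_all add: measure_matrix_image S)
  then show ?thesis
    using det by (simp add: mult.assoc[symmetric] abs_mult[symmetric])
qed

section \<open>Lattice bases, integer coordinates and the lattice determinant\<close>

lemma det_Ints:
  fixes A :: "real^'n::finite^'n"
  assumes "\<And>i j. A $ i $ j \<in> \<int>"
  shows "det A \<in> \<int>"
  unfolding det_def using assms by (intro Ints_sum Ints_mult Ints_prod) auto

lemma matrix_of_columns_mult:
  "(\<chi> i j. f j $ i) *v z = (\<Sum>j\<in>UNIV. z $ j *s f j)" for z :: "real^'n::finite"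
  by (simp add: matrix_vector_mult_def vec_eq_iff mult.commute)

lemma euclidean_lattice_sum:
  assumes L: "euclidean_lattice \<Lambda>" and f: "\<And>j. f j \<in> \<Lambda>" and z: "\<And>j. z j \<in> \<int>"
  shows "(\<Sum>j\<in>A. z j *s f j) \<in> \<Lambda>"
proof -
  have zero: "0 \<in> \<Lambda>" and diff: "\<And>x y. x \<in> \<Lambda> \<Longrightarrow> y \<in> \<Lambda> \<Longrightarrow> x - y \<in> \<Lambda>"
    using L by (auto simp: euclidean_lattice_def)
  have neg: "- x \<in> \<Lambda>" if "x \<in> \<Lambda>" for x
    using diff[OF zero that] by simp
  have add: "x + y \<in> \<Lambda>" if "x \<in> \<Lambda>" "y \<in> \<Lambda>" for x y
    using diff[OF that(1) neg[OF that(2)]] by simp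
  have nat: "real k *s x \<in> \<Lambda>" if "x \<in> \<Lambda>" for k x
    by (induction k) (auto simp: zero vector_sadd_rdistrib that intro: add)
  have "t *s x \<in> \<Lambda>" if t: "t \<in> \<int>" and x: "x \<in> \<Lambda>" for t x
  proof -
    obtain k where "t = real k \<or> t = - real k"
      using t by (metis Ints_cases int_cases2 of_int_minus of_int_of_nat_eq)
    then show ?thesis
      using nat[OF x, of k] neg by (auto simp: vector_smult_lneg)
  qed
  then show ?thesis
    by (induction A rule: infinite_finite_induct) (auto intro: add zero f z)
qed

text \<open>
  Packing a small ball bounds the determinants of independent systems in the lattice away from 0.
  A system whose determinant is less than twice the infimum is a basis: if some coordinate of
  a lattice point were not an integer, replacing the corresponding column by that point, with
  this coordinate reduced to at most 1/2 in absolute value, would at least halve the determinant.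
\<close>

lemma lattice_basis_exists:
  fixes \<Lambda> :: "(real^'d::finite) set"
  assumes L: "euclidean_lattice \<Lambda>"
  obtains B where "lattice_basis \<Lambda> B"
proof -
  define M where "M = (\<lambda>f :: 'd \<Rightarrow> real^'d. \<chi> i j. f j $ i)"
  define D where "D = {\<bar>det (M f)\<bar> | f. (\<forall>j. f j \<in> \<Lambda>) \<and> det (M f) \<noteq> 0}"
  have "0 \<in> \<Lambda>" and diff: "\<And>x y. x \<in> \<Lambda> \<Longrightarrow> y \<in> \<Lambda> \<Longrightarrow> x - y \<in> \<Lambda>"
    and disc: "discrete \<Lambda>" and dim: "dim \<Lambda> = CARD('d)"
    using L by (auto simp: euclidean_lattice_def)
  obtain e where e: "e > 0" "\<And>x. x \<in> \<Lambda> \<Longrightarrow> norm x < e \<Longrightarrow> x = 0"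
    using discreteD[OF disc \<open>0 \<in> \<Lambda>\<close>] unfolding isolated_in_dist_Ex_iff
    by (auto simp: dist_norm)
  have image: "M f *v z \<in> \<Lambda>" if "\<And>j. f j \<in> \<Lambda>" "\<And>j. z $ j \<in> \<int>" for f z
    unfolding M_def matrix_of_columns_mult using euclidean_lattice_sum[OF L] that by blast
  \<comment> \<open>With radius \<open>e / 3\<close>, two points of the ball differ by less than
    \<open>e\<close>, so the ball packs under every sublattice of \<open>\<Lambda>\<close>.\<close>
  define \<epsilon> where "\<epsilon> = measure lborel (cball (0 :: real^'d) (e / 3))"
  have "\<epsilon> > 0"
    unfolding \<epsilon>_def using e(1) by (intro content_cball_pos) auto
  have lower: "\<epsilon> \<le> \<delta>" if "\<delta> \<in> D" for \<delta>
  proof -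
    obtain f where f: "\<And>j. f j \<in> \<Lambda>" "det (M f) \<noteq> 0" "\<delta> = \<bar>det (M f)\<bar>"
      using \<open>\<delta> \<in> D\<close> by (auto simp: D_def)
    show ?thesis
      unfolding f(3) \<epsilon>_def
    proof (rule lattice_packing_measure_le)
      show "invertible (M f)"
        using f(2) by (simp add: invertible_det_nz)
      fix x y z :: "real^'d"
      assume xy: "x \<in> cball 0 (e / 3)" "y \<in> cball 0 (e / 3)"
        and z: "\<And>i. z $ i \<in> \<int>" and eq: "x - y = M f *v z"
      have "norm (x - y) < e"
        using xy norm_triangle_ineq4[of x y] e(1) by simp
      then show "x = y"
        using e(2)[of "x - y"] image[OF f(1) z] eq by simp
    qed simp
  qed
  have "D \<noteq> {}"
  proof -
    obtain A where A: "A \<subseteq> \<Lambda>" "independent A" "card A = CARD('d)"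
      using basis_exists[of \<Lambda>] dim by metis
    then obtain f where f: "bij_betw f (UNIV :: 'd set) A"
      using bij_betw_iff_card[of "UNIV :: 'd set" A] independent_imp_finite[OF A(2)] by auto
    have cols: "columns (M f) = A"
      using f by (auto simp: columns_def column_def M_def bij_betw_def vec_lambda_eta)
    have "span A = UNIV"
      using A independent_imp_finite[OF A(2)] card_ge_dim_independent[of A UNIV] by auto
    then have "invertible (M f)"
      by (metis cols invertible_right_inverse matrix_right_invertible_span_columns span_vec_eq)
    then show ?thesis
      using f A(1) by (force simp: D_def invertible_det_nz bij_betw_def)
  qed
  have "Inf D \<ge> \<epsilon>"
    using \<open>D \<noteq> {}\<close> lower by (intro cInf_greatest) auto
  then have "Inf D < 2 * Inf D"
    using \<open>\<epsilon> > 0\<close> by simp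
  then obtain \<delta> where \<delta>: "\<delta> \<in> D" "\<delta> < 2 * Inf D"
    using cInf_lessD[OF \<open>D \<noteq> {}\<close>] by blast
  then obtain f where f: "\<And>j. f j \<in> \<Lambda>" "det (M f) \<noteq> 0" "\<delta> = \<bar>det (M f)\<bar>"
    by (auto simp: D_def)
  have int: "y $ k \<in> \<int>" if x: "M f *v y \<in> \<Lambda>" for y k
  proof (rule ccontr)
    assume "y $ k \<notin> \<int>"
    define t where "t = y $ k - of_int (round (y $ k))"
    have t: "t \<noteq> 0" "\<bar>t\<bar> \<le> 1 / 2"
      using \<open>y $ k \<notin> \<int>\<close> of_int_round_abs_le[of "y $ k"]
      by (auto simp: t_def abs_minus_commute) (metis Ints_of_int)
    define y' where "y' = y - of_int (round (y $ k)) *s axis k 1"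
    define g where "g = f(k := M f *v y')"
    have "M f *v y' = M f *v y - M f *v (of_int (round (y $ k)) *s axis k 1)"
      by (simp add: y'_def matrix_vector_mult_diff_distrib)
    also have "\<dots> \<in> \<Lambda>"
      by (intro diff x image f(1)) (auto simp: axis_def)
    finally have g: "g j \<in> \<Lambda>" for j
      using f(1) by (simp add: g_def)
    \<comment> \<open>Cramer's rule: replacing column \<open>k\<close> by \<open>M f *v y'\<close>
      multiplies the determinant by \<open>y' $ k\<close>.\<close>
    have "M g = (\<chi> i j. if j = k then (M f *v y') $ i else M f $ i $ j)"
      by (simp add: M_def g_def vec_eq_iff)
    then have "det (M g) = y' $ k * det (M f)"
      by (simp only: cramer_lemma)
    also have "y' $ k = t"
      by (simp add: y'_def t_def)
    finally have det: "det (M g) = t * det (M f)" .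
    then have "det (M g) \<noteq> 0"
      using t(1) f(2) by simp
    then have "\<bar>det (M g)\<bar> \<in> D"
      using g unfolding D_def by blast
    then have "Inf D \<le> \<bar>det (M g)\<bar>"
      using lower by (intro cInf_lower bdd_belowI[of _ \<epsilon>]) auto
    also have "\<dots> \<le> 1 / 2 * \<bar>det (M f)\<bar>"
      unfolding det abs_mult using t(2) by (intro mult_right_mono) auto
    finally show False
      using \<delta>(2) f(3) by simp
  qed
  have "\<exists>z. x = M f *v z \<and> (\<forall>i. z $ i \<in> \<int>)" if "x \<in> \<Lambda>" for x
  proof -
    obtain y where "M f *v y = x"
      using f(2) unfolding invertible_det_nz[symmetric] invertible_eq_bij
      by (metis bij_pointE)
    with int that show ?thesis
      by metis
  qed
  then have "lattice_basis \<Lambda> (M f)"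
    using image f(1,2) by (auto simp: lattice_basis_def invertible_det_nz)
  then show ?thesis ..
qed

text \<open>The columns of \<open>U\<close> are the integer coordinates of the columns of
  \<open>M\<close>. This serves both to compare two bases and to recognise relative volumes as
  integers.\<close>

lemma lattice_basis_coordinates:
  fixes B M :: "real^'d::finite^'d"
  assumes B: "lattice_basis \<Lambda> B" and M: "\<And>j. column j M \<in> \<Lambda>"
  obtains U where "M = B ** U" "det U \<in> \<int>"
proof -
  have "\<exists>z. column j M = B *v z \<and> (\<forall>i. z $ i \<in> \<int>)" for j
    using M[of j] B by (auto simp: lattice_basis_def)
  then obtain u where u: "\<And>j. column j M = B *v u j" "\<And>i j. u j $ i \<in> \<int>"
    by metis
  have "M = B ** (\<chi> i j. u j $ i)"
    using u(1) by (simp add: vec_eq_iff column_def matrix_vector_mult_def matrix_matrix_mult_def)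
  moreover have "det (\<chi> i j. u j $ i) \<in> \<int>"
    using u(2) by (intro det_Ints) simp
  ultimately show ?thesis
    by (rule that)
qed

lemma lattice_basis_column:
  assumes "lattice_basis \<Lambda> B"
  shows "column j B \<in> \<Lambda>"
proof -
  have "column j B = B *v axis j 1"
    by (simp add: matrix_vector_mult_basis)
  moreover have "axis j 1 $ i \<in> (\<int> :: real set)" for i
    by (simp add: axis_def)
  ultimately show ?thesis
    using assms by (auto simp: lattice_basis_def)
qed

text \<open>The matrix of a base change has a nonzero integer determinant, so one of absolute value
  at least 1. Exchanging \<open>B\<close> and \<open>C\<close> turns the inequality into the
  uniqueness that \<open>lattice_det\<close> rests on.\<close>

lemma lattice_basis_det_le:
  assumes B: "lattice_basis \<Lambda> B" and C: "lattice_basis \<Lambda> C"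
  shows "\<bar>det B\<bar> \<le> \<bar>det C\<bar>"
proof -
  obtain U where U: "C = B ** U" "det U \<in> \<int>"
    using lattice_basis_coordinates[OF B lattice_basis_column[OF C]] .
  have "det C \<noteq> 0"
    using C by (simp add: lattice_basis_def invertible_det_nz)
  then have "det U \<noteq> 0"
    by (simp add: U det_mul)
  then have "\<bar>det U\<bar> \<ge> 1"
    using U(2) by (rule Ints_nonzero_abs_ge1[rotated])
  then have "\<bar>det B\<bar> * 1 \<le> \<bar>det B\<bar> * \<bar>det U\<bar>"
    by (intro mult_left_mono) auto
  then show ?thesis
    by (simp add: U det_mul abs_mult)
qed

lemma lattice_det_eq:
  assumes B: "lattice_basis \<Lambda> B"
  shows "lattice_det \<Lambda> = \<bar>det B\<bar>"
  unfolding lattice_det_def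
proof (rule the_equality)
  show "\<exists>C. lattice_basis \<Lambda> C \<and> \<bar>det B\<bar> = \<bar>det C\<bar>"
    using B by blast
  show "\<delta> = \<bar>det B\<bar>" if "\<exists>C. lattice_basis \<Lambda> C \<and> \<delta> = \<bar>det C\<bar>" for \<delta>
    using that B lattice_basis_det_le by (blast intro: antisym)
qed

section \<open>Relative volumes of Delone simplices: integrality and boundedness\<close>

lemma delone_simplex_relative_volume:
  fixes \<Lambda> :: "(real^'d::finite) set"
  assumes L: "euclidean_lattice \<Lambda>" and S: "delone_simplex \<Lambda> S"
  shows "relative_volume \<Lambda> S \<in> \<int>" "0 \<le> relative_volume \<Lambda> S"
    "relative_volume \<Lambda> S \<le> (real CARD('d) + 1) ^ CARD('d)"
proof -
  define d where "d = real CARD('d)"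
  have d: "d > 0"
    by (simp add: d_def)
  obtain B where B: "lattice_basis \<Lambda> B"
    using lattice_basis_exists[OF L] .
  have diff: "\<And>x y. x \<in> \<Lambda> \<Longrightarrow> y \<in> \<Lambda> \<Longrightarrow> x - y \<in> \<Lambda>" and "0 \<in> \<Lambda>"
    using L by (auto simp: euclidean_lattice_def)
  have add: "x + y \<in> \<Lambda>" if "x \<in> \<Lambda>" "y \<in> \<Lambda>" for x y
    using diff[OF that(1) diff[OF \<open>0 \<in> \<Lambda>\<close> that(2)]] by simp
  obtain V c r where V: "V \<subseteq> \<Lambda>" "card V = CARD('d) + 1" "S = convex hull V"
    and r: "r > 0" "\<And>v. v \<in> V \<Longrightarrow> norm (v - c) = r" "\<And>v. v \<in> \<Lambda> - V \<Longrightarrow> norm (v - c) > r"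
    using S unfolding delone_simplex_def by blast
  have "finite V" "V \<noteq> {}"
    using V(2) by (auto intro: card_ge_0_finite)
  then obtain a where a: "a \<in> V"
    by auto
  then obtain f where f: "bij_betw f (UNIV :: 'd set) (V - {a})"
    using bij_betw_iff_card[of "UNIV :: 'd set" "V - {a}"] V(2) \<open>finite V\<close> by auto
  define M :: "real^'d^'d" where "M = (\<chi> i j. (f j - a) $ i)"
  have col: "column j M = f j - a" for j
    by (simp add: M_def column_def vec_eq_iff)
  have fV: "f j \<in> V" for j
    using f by (auto simp: bij_betw_def)
  have "V = insert a ((\<lambda>i. a + column i M) ` UNIV)"
    using f a unfolding col by (auto simp: bij_betw_def)
  then have vol: "relative_volume \<Lambda> S = \<bar>det M\<bar> / \<bar>det B\<bar>"
    by (simp add: relative_volume_def V(3) measure_simplex lattice_det_eq[OF B])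
  have "det B \<noteq> 0"
    using B by (simp add: lattice_basis_def invertible_det_nz)
  have "column j M \<in> \<Lambda>" for j
    using diff fV a V(1) by (auto simp: col)
  then obtain U where U: "M = B ** U" "det U \<in> \<int>"
    using lattice_basis_coordinates[OF B] by blast
  have "relative_volume \<Lambda> S = \<bar>det U\<bar>"
    using \<open>det B \<noteq> 0\<close> by (simp add: vol U det_mul abs_mult)
  then show "relative_volume \<Lambda> S \<in> \<int>" "0 \<le> relative_volume \<Lambda> S"
    using U(2) by auto

  have far: "r \<le> norm (v - c)" if "v \<in> \<Lambda>" for v
    using r(2,3)[of v] that by force
  have inner_le: "2 * \<bar>w \<bullet> (v - c)\<bar> \<le> w \<bullet> w" if w: "w \<in> \<Lambda>" and v: "v \<in> V" for v w
  proof -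
    have "v \<in> \<Lambda>" using v V(1) by auto
    have "r\<^sup>2 \<le> (norm (v + w - c))\<^sup>2" "r\<^sup>2 \<le> (norm (v - w - c))\<^sup>2"
      using r(1) far add diff w \<open>v \<in> \<Lambda>\<close> by (auto intro!: power_mono)
    moreover have "(norm (v + w - c))\<^sup>2 = r\<^sup>2 + 2 * (w \<bullet> (v - c)) + w \<bullet> w"
      "(norm (v - w - c))\<^sup>2 = r\<^sup>2 - 2 * (w \<bullet> (v - c)) + w \<bullet> w"
      unfolding r(2)[OF v, symmetric] power2_norm_eq_inner
      by (simp_all add: inner_diff inner_add algebra_simps inner_commute)
    ultimately show ?thesis
      by (simp add: abs_if)
  qed
  \<comment> \<open>Differences of points of this box have \<open>d\<close> coordinates of absolute
    value at most \<open>1 / (d + 1)\<close>. Each edge contributes at most that multiple of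
    \<open>w \<bullet> w\<close>, and the total factor \<open>d / (d + 1)\<close> is below
    1.\<close>
  have "measure lborel ((*v) M ` cbox 0 (\<chi> i. 1 / (d + 1))) \<le> \<bar>det B\<bar>"
  proof (rule lattice_packing_measure_le)
    show "invertible B"
      using B by (simp add: lattice_basis_def)
    show "compact ((*v) M ` cbox 0 (\<chi> i. 1 / (d + 1)))"
      by (intro compact_continuous_image linear_continuous_on linear_linear[THEN iffD2]) auto
    fix x y z
    assume xy: "x \<in> (*v) M ` cbox 0 (\<chi> i. 1 / (d + 1))" "y \<in> (*v) M ` cbox 0 (\<chi> i. 1 / (d + 1))"
      and z: "\<And>i. z $ i \<in> \<int>" "x - y = B *v z"
    from xy obtain p q where pq: "p \<in> cbox 0 (\<chi> i. 1 / (d + 1))" "q \<in> cbox 0 (\<chi> i. 1 / (d + 1))"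
      "x = M *v p" "y = M *v q"
      by auto
    define w where "w = x - y"
    have w: "w \<in> \<Lambda>"
      using B z by (auto simp: w_def lattice_basis_def)
    have b: "\<bar>(p - q) $ i\<bar> \<le> 1 / (d + 1)" for i
    proof -
      have "0 \<le> p $ i" "p $ i \<le> 1 / (d + 1)" "0 \<le> q $ i" "q $ i \<le> 1 / (d + 1)"
        using pq(1,2) by (auto simp: mem_box_cart)
      then show ?thesis by (simp add: abs_le_iff)
    qed
    \<comment> \<open>An edge is the difference of two vertices; the factor 2 in
      \<open>inner_le\<close> absorbs the triangle inequality.\<close>
    have edge: "\<bar>w \<bullet> (f i - a)\<bar> \<le> w \<bullet> w" for i
    proof -
      have "w \<bullet> (f i - a) = w \<bullet> (f i - c) - w \<bullet> (a - c)"
        by (simp add: inner_diff_right)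
      then show ?thesis
        using inner_le[OF w fV[of i]] inner_le[OF w a] by linarith
    qed
    have "w = M *v (p - q)"
      by (simp add: w_def pq matrix_vector_mult_diff_distrib)
    also have "\<dots> = (\<Sum>i\<in>UNIV. (p - q) $ i *s (f i - a))"
      unfolding matrix_mult_sum col ..
    finally have "w \<bullet> w = w \<bullet> (\<Sum>i\<in>UNIV. (p - q) $ i *s (f i - a))"
      by simp
    also have "\<dots> = (\<Sum>i\<in>UNIV. (p - q) $ i * (w \<bullet> (f i - a)))"
      by (simp add: inner_sum_right scalar_mult_eq_scaleR)
    also have "\<dots> \<le> (\<Sum>i\<in>(UNIV :: 'd set). 1 / (d + 1) * (w \<bullet> w))"
    proof (rule sum_mono)
      fix i
      have "(p - q) $ i * (w \<bullet> (f i - a)) \<le> \<bar>(p - q) $ i\<bar> * \<bar>w \<bullet> (f i - a)\<bar>"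
        by (metis abs_ge_self abs_mult)
      also have "\<dots> \<le> 1 / (d + 1) * (w \<bullet> w)"
        using b edge d by (intro mult_mono) auto
      finally show "(p - q) $ i * (w \<bullet> (f i - a)) \<le> 1 / (d + 1) * (w \<bullet> w)" .
    qed
    also have "\<dots> = d / (d + 1) * (w \<bullet> w)"
      by (simp add: d_def)
    finally have "(w \<bullet> w) * (d + 1) \<le> d * (w \<bullet> w)"
      using d by (simp add: field_simps)
    then have "w \<bullet> w \<le> 0"
      by (simp add: algebra_simps)
    then have "w \<bullet> w = 0"
      using inner_ge_zero[of w] by linarith
    then show "x = y"
      by (simp add: w_def)
  qed
  also have "measure lborel ((*v) M ` cbox 0 (\<chi> i. 1 / (d + 1))) = \<bar>det M\<bar> * (1 / (d + 1)) ^ CARD('d)"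
    using d by (subst measure_matrix_image) (auto simp: content_cbox_cart interval_ne_empty_cart)
  finally have "\<bar>det M\<bar> \<le> (d + 1) ^ CARD('d) * \<bar>det B\<bar>"
    using d by (simp add: power_divide field_simps)
  then show "relative_volume \<Lambda> S \<le> (real CARD('d) + 1) ^ CARD('d)"
    using \<open>det B \<noteq> 0\<close> by (simp add: vol d_def divide_le_eq)
qed

text \<open>\<open>Max\<close> bounds the members of a finite set; integrality and the dimension
  bound confine all relative volumes to finitely many integers.\<close>

lemma relative_volume_le_mv:
  fixes \<Lambda> :: "(real^'d::finite) set"
  assumes "euclidean_lattice \<Lambda>" "delone_simplex \<Lambda> S"
  shows "relative_volume \<Lambda> S \<le> mv TYPE('d)"
proof -
  let ?R = "{relative_volume \<Lambda> L | \<Lambda> (L :: (real^'d) set). euclidean_lattice \<Lambda> \<and> delone_simplex \<Lambda> L}"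
  have "?R \<subseteq> real_of_int ` {0..(int CARD('d) + 1) ^ CARD('d)}"
  proof
    fix v assume "v \<in> ?R"
    then have v: "v \<in> \<int>" "0 \<le> v" "v \<le> (real CARD('d) + 1) ^ CARD('d)"
      using delone_simplex_relative_volume by auto
    then obtain k where k: "v = of_int k"
      by (auto elim: Ints_cases)
    have "real_of_int k \<le> real_of_int ((int CARD('d) + 1) ^ CARD('d))"
      using v(3) k by simp
    then have "k \<le> (int CARD('d) + 1) ^ CARD('d)"
      by (simp only: of_int_le_iff)
    then show "v \<in> real_of_int ` {0..(int CARD('d) + 1) ^ CARD('d)}"
      using v(2) k by auto
  qed
  then have "finite ?R"
    by (rule finite_subset) auto
  then show ?thesis
    unfolding mv_def using assms by (intro Max_ge) auto
qed

section \<open>The simplex code and its lattice\<close>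

text \<open>Only the identity contributes to the Leibniz sum. If \<open>p\<close> moves
  \<open>i\<close> and its product is nonzero, then \<open>p i\<close> lies in \<open>S\<close>; row
  \<open>p i\<close> is zero off the diagonal, so \<open>p\<close> also fixes \<open>p i\<close>,
  against injectivity.\<close>

lemma det_eq_prod_diag:
  fixes M :: "'a::comm_ring_1^'n::finite^'n"
  assumes off: "\<And>i j. i \<noteq> j \<Longrightarrow> M $ i $ j \<noteq> 0 \<Longrightarrow> i \<notin> S \<and> j \<in> S"
  shows "det M = (\<Prod>i\<in>UNIV. M $ i $ i)"
proof -
  have zero: "(\<Prod>i\<in>UNIV. M $ i $ p i) = 0" if p: "p permutes UNIV" and "p \<noteq> id" for p
  proof (rule ccontr)
    assume "(\<Prod>i\<in>UNIV. M $ i $ p i) \<noteq> 0"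
    then have nz: "M $ i $ p i \<noteq> 0" for i
      by (meson finite UNIV_I prod_zero)
    obtain i where i: "p i \<noteq> i"
      using \<open>p \<noteq> id\<close> by (auto simp: fun_eq_iff)
    then have "p i \<in> S"
      using off nz by metis
    then have "p (p i) = p i"
      using off nz by metis
    then show False
      using i p by (metis permutes_def)
  qed
  have "det M = (\<Sum>p\<in>{id}. of_int (sign p) * (\<Prod>i\<in>UNIV. M $ i $ p i))"
    unfolding det_def by (rule sum.mono_neutral_right) (auto simp: permutes_id zero finite_permutations)
  then show ?thesis
    by simp
qed

text \<open>For the identity plus the all-ones matrix, \<open>C\<close> subtracts column
  \<open>k\<close> from the other columns and \<open>R\<close> then adds all other rows to row
  \<open>k\<close>. The result \<open>T\<close> is diagonal except in column
  \<open>k\<close>.\<close>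

lemma det_mat_1_plus_ones:
  "det ((\<chi> i j. if i = j then 2 else 1) :: real^'n::finite^'n) = real CARD('n) + 1"
proof -
  \<comment> \<open>Any index serves as the pivot.\<close>
  define k :: 'n where "k = undefined"
  define J :: "real^'n^'n" where "J = (\<chi> i j. if i = j then 2 else 1)"
  define R :: "real^'n^'n" where "R = (\<chi> i j. if i = j \<or> i = k then 1 else 0)"
  define C :: "real^'n^'n" where "C = (\<chi> i j. if i = j then 1 else if i = k then -1 else 0)"
  define T :: "real^'n^'n" where
    "T = (\<chi> i j. if i = j then if i = k then real CARD('n) + 1 else 1 else if j = k then 1 else 0)"
  have "det R = 1"
    by (subst det_eq_prod_diag[where S = "- {k}"]) (auto simp: R_def split: if_splits)
  have "det C = 1"
    by (subst det_eq_prod_diag[where S = "- {k}"]) (auto simp: C_def split: if_splits)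
  have "det T = real CARD('n) + 1"
    by (subst det_eq_prod_diag[where S = "{k}"]) (auto simp: T_def split: if_splits)
  have JC: "J ** C = (\<chi> i j. if j = k then J $ i $ k else J $ i $ j - J $ i $ k)"
  proof -
    have "(\<Sum>l\<in>UNIV. J $ i $ l * C $ l $ j) = (if j = k then J $ i $ k else J $ i $ j - J $ i $ k)" for i j
    proof -
      have "J $ i $ l * C $ l $ j = (if l = j then J $ i $ j else 0) +
          (if l = k then if j = k then 0 else - J $ i $ k else 0)" for l
        by (auto simp: C_def)
      then show ?thesis
        by (simp add: sum.distrib)
    qed
    then show ?thesis
      by (simp add: matrix_matrix_mult_def)
  qed
  have "R ** (J ** C) = T"
  proof -
    have "(\<Sum>l\<in>UNIV. R $ i $ l * (J ** C) $ l $ j) = T $ i $ j" for i j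
    proof (cases "i = k")
      case False
      then have "R $ i $ l * (J ** C) $ l $ j = (if l = i then (J ** C) $ i $ j else 0)" for l
        by (auto simp: R_def)
      then have "(\<Sum>l\<in>UNIV. R $ i $ l * (J ** C) $ l $ j) = (J ** C) $ i $ j"
        by simp
      then show ?thesis
        using False by (simp add: JC) (auto simp: J_def T_def)
    next
      case True
      then have "(\<Sum>l\<in>UNIV. R $ i $ l * (J ** C) $ l $ j) = (\<Sum>l\<in>UNIV. (J ** C) $ l $ j)"
        by (simp add: R_def)
      also have "\<dots> = (\<Sum>l\<in>UNIV. if j = k then 1 + (if l = k then 1 else 0)
          else (if l = j then 1 else 0) - (if l = k then 1 else 0))"
        by (intro sum.cong; simp add: JC) (auto simp: J_def)
      also have "\<dots> = T $ i $ j"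
        using True by (auto simp: T_def sum.distrib sum_subtractf)
      finally show ?thesis .
    qed
    then show ?thesis
      by (simp add: matrix_matrix_mult_def[of R] vec_eq_iff)
  qed
  then have "det R * (det J * det C) = det T"
    by (metis det_mul)
  then show ?thesis
    using \<open>det R = 1\<close> \<open>det C = 1\<close> \<open>det T = _\<close> by (simp add: J_def)
qed

text \<open>Orthogonality of the characters of the group of subsets of \<open>N\<close>: the sum
  factors as the product of \<open>g k + 1\<close> over \<open>N\<close>, and a point in just one of
  \<open>T\<close> and \<open>S\<close> gives a factor 0.\<close>

lemma characters_orthogonal:
  assumes N: "finite N" and T: "T \<subseteq> N" "S \<subseteq> N"
  shows "(\<Sum>X\<in>Pow N. (-1) ^ card (T \<inter> X) * (-1) ^ card (S \<inter> X)) =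
    (if T = S then 2 ^ card N else (0 :: real))"
proof -
  define g where "g = (\<lambda>k. if (k \<in> T) = (k \<in> S) then 1 else (-1 :: real))"
  have pow: "(-1 :: real) ^ card (T \<inter> X) = (\<Prod>k\<in>X. if k \<in> T then -1 else 1)" if "X \<subseteq> N" for T X
  proof -
    have "finite X" using N that by (rule finite_subset[rotated])
    then show ?thesis
      by (simp add: prod.If_cases Int_commute)
  qed
  have "(\<Sum>X\<in>Pow N. (-1) ^ card (T \<inter> X) * (-1) ^ card (S \<inter> X)) =
      (\<Sum>X\<in>Pow N. (\<Prod>k\<in>X. g k) * (\<Prod>k\<in>N - X. 1))"
    by (intro sum.cong) (auto simp: pow prod.distrib[symmetric] g_def intro!: prod.cong)
  also have "\<dots> = (\<Prod>k\<in>N. g k + 1)"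
    by (rule prod_add[symmetric, OF N])
  also have "\<dots> = (if T = S then 2 ^ card N else 0)"
  proof (cases "T = S")
    case True
    then show ?thesis by (simp add: g_def)
  next
    case False
    then obtain k where "k \<in> N" "(k \<in> T) \<noteq> (k \<in> S)"
      using T by blast
    then have "k \<in> N" "g k + 1 = 0"
      by (simp_all add: g_def)
    then have "(\<Prod>k\<in>N. g k + 1) = 0"
      using N by (intro prod_zero) auto
    with False show ?thesis by simp
  qed
  finally show ?thesis .
qed

text \<open>Discreteness is a hypothesis here because for \<open>code_lattice\<close> it is
  immediate from integrality of the coordinates.\<close>

lemma lattice_basis_imp_euclidean_lattice:
  fixes B :: "real^'d::finite^'d"
  assumes B: "lattice_basis \<Lambda> B" and disc: "discrete \<Lambda>"
  shows "euclidean_lattice \<Lambda>"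
proof -
  have \<Lambda>: "\<Lambda> = {B *v z | z. \<forall>i. z $ i \<in> \<int>}" and inv: "invertible B"
    using B by (auto simp: lattice_basis_def)
  have "0 \<in> \<Lambda>"
    unfolding \<Lambda> by (intro CollectI exI[of _ 0]) auto
  moreover have "x - y \<in> \<Lambda>" if xy: "x \<in> \<Lambda>" "y \<in> \<Lambda>" for x y
  proof -
    obtain p q where "x = B *v p" "y = B *v q" "\<forall>i. p $ i \<in> \<int>" "\<forall>i. q $ i \<in> \<int>"
      using xy by (auto simp: \<Lambda>)
    then show ?thesis
      unfolding \<Lambda> by (intro CollectI exI[of _ "p - q"]) (auto simp: matrix_vector_mult_diff_distrib)
  qed
  moreover have "dim \<Lambda> = CARD('d)"
  proof -
    have "columns B \<subseteq> \<Lambda>"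
      using lattice_basis_column[OF B] by (auto simp: columns_def)
    moreover have "span (columns B) = UNIV"
      using inv by (metis invertible_right_inverse matrix_right_invertible_span_columns span_vec_eq)
    ultimately have "span \<Lambda> = UNIV"
      using span_mono by blast
    then show ?thesis
      by (metis DIM_cart DIM_real dim_UNIV dim_span mult.right_neutral)
  qed
  ultimately show ?thesis
    using disc by (simp add: euclidean_lattice_def)
qed

text \<open>
  The coordinates are indexed by the nonempty subsets of \<open>{..<n}\<close>, so that the words of the
  binary simplex code are the functions \<open>X \<mapsto> card (T \<inter> X) mod 2\<close> for \<open>T \<subseteq> {..<n}\<close>.
\<close>

locale simplex_code =
  fixes A :: "'d::finite \<Rightarrow> nat set" and n :: nat
  assumes bij: "bij_betw A UNIV (Pow {..<n} - {{}})"
begin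

definition code :: "nat set \<Rightarrow> real^'d" where
  "code T = (\<chi> i. of_bool (odd (card (T \<inter> A i))))"

text \<open>This matrix is symmetric: its entries are the parities of
  \<open>card (A j \<inter> A i)\<close>. It is the Sylvester Hadamard matrix without its constant
  row and column, with signs 1 and -1 rewritten as 0 and 1.\<close>

definition code_matrix :: "real^'d^'d" where
  "code_matrix = (\<chi> i j. code (A j) $ i)"

text \<open>This is Construction A of coding theory, applied to the simplex code.\<close>

definition code_lattice :: "(real^'d) set" where
  "code_lattice = {\<chi> i. real_of_int (u i) | u.
     \<exists>T\<subseteq>{..<n}. \<forall>i. odd (u i) \<longleftrightarrow> odd (card (T \<inter> A i))}"

text \<open>
  The singletons form an information set of the code: the words with a single nonzero
  coordinate there, together with twice the remaining unit vectors, generate the lattice.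
\<close>

definition code_basis :: "real^'d^'d" where
  "code_basis = (\<chi> i j. if card (A j) = 1 then of_bool (A j \<subseteq> A i) else if i = j then 2 else 0)"

text \<open>Meaningful only for \<open>k < n\<close>, where \<open>{k}\<close> is in the range of
  \<open>A\<close>.\<close>

definition singleton_index :: "nat \<Rightarrow> 'd" where
  "singleton_index k = inv A {k}"

lemma A_props: "A i \<subseteq> {..<n}" "A i \<noteq> {}" "finite (A i)"
  using bij by (auto simp: bij_betw_def intro: finite_subset[of _ "{..<n}"])

lemma A_inj: "A i = A j \<longleftrightarrow> i = j"
  using bij by (auto simp: bij_betw_def inj_eq)

lemma A_surj: "T \<subseteq> {..<n} \<Longrightarrow> T \<noteq> {} \<Longrightarrow> \<exists>i. T = A i"
  using bij unfolding bij_betw_def by blast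

lemma card_eq: "real CARD('d) + 1 = 2 ^ n"
proof -
  have "CARD('d) = card (Pow {..<n} - {{}})"
    using bij by (rule bij_betw_same_card)
  also have "\<dots> = 2 ^ n - 1"
    by (simp add: card_Diff_subset card_Pow)
  finally show ?thesis
    by (simp add: of_nat_diff)
qed

lemma A_singleton_index: "k < n \<Longrightarrow> A (singleton_index k) = {k}"
  using A_surj[of "{k}"] unfolding singleton_index_def
  by (metis f_inv_into_f insert_not_empty lessThan_iff empty_subsetI insert_subset rangeI)

lemma singleton_index_inj: "inj_on singleton_index {..<n}"
  by (metis A_singleton_index inj_onI lessThan_iff singleton_inject)

lemma singleton_index_image: "singleton_index ` {k \<in> X. k < n} = {j. card (A j) = 1 \<and> A j \<subseteq> X}"
proof (intro equalityI subsetI)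
  fix j assume "j \<in> {j. card (A j) = 1 \<and> A j \<subseteq> X}"
  then obtain k where k: "A j = {k}" "k \<in> X"
    by (auto simp: card_1_singleton_iff)
  then have "k < n"
    using A_props(1)[of j] by auto
  then have "j = singleton_index k"
    using A_singleton_index k(1) A_inj by metis
  then show "j \<in> singleton_index ` {k \<in> X. k < n}"
    using k \<open>k < n\<close> by auto
qed (auto simp: A_singleton_index)

text \<open>By symmetry this is the Gram matrix of the nonzero words: each has weight
  \<open>2 ^ n / 2\<close>, and two distinct ones share \<open>2 ^ n / 4\<close> ones.\<close>

lemma code_matrix_square:
  "code_matrix ** code_matrix = (\<chi> i j. 2 ^ n / 4 * (if i = j then 2 else 1))"
proof -
  have ew: "of_bool (odd (card X)) = (1 - (-1 :: real) ^ card X) / 2" for X :: "nat set"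
    by (auto simp: minus_one_power_iff)
  define \<chi>' where "\<chi>' T X = (-1 :: real) ^ card (T \<inter> X)" for T X :: "nat set"
  have orth: "(\<Sum>X\<in>Pow {..<n}. \<chi>' T X * \<chi>' S X) = (if T = S then 2 ^ n else 0)"
    if "T \<subseteq> {..<n}" "S \<subseteq> {..<n}" for T S
    using characters_orthogonal[of "{..<n}" T S] that by (simp add: \<chi>'_def)
  have "(\<Sum>k\<in>UNIV. code (A k) $ i * code (A j) $ k) = 2 ^ n / 4 * (if i = j then 2 else 1)" for i j
  proof -
    have "(\<Sum>k\<in>UNIV. code (A k) $ i * code (A j) $ k) =
        (\<Sum>k\<in>UNIV. (1 - \<chi>' (A i) (A k)) * (1 - \<chi>' (A j) (A k)) / 4)"
      by (simp add: code_def ew \<chi>'_def Int_commute)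
    also have "\<dots> = (\<Sum>X\<in>Pow {..<n} - {{}}. (1 - \<chi>' (A i) X) * (1 - \<chi>' (A j) X) / 4)"
      by (rule sum.reindex_bij_betw[OF bij])
    \<comment> \<open>The empty set may be included, since every character takes the value 1 there
      and its term vanishes.\<close>
    also have "\<dots> = (\<Sum>X\<in>Pow {..<n}. (1 - \<chi>' (A i) X) * (1 - \<chi>' (A j) X) / 4)"
      by (rule sum.mono_neutral_left) (auto simp: \<chi>'_def)
    \<comment> \<open>Writing the constant 1 as the character of \<open>{}\<close> makes
      orthogonality apply to all four sums; the middle two vanish as \<open>A i\<close> and
      \<open>A j\<close> are nonempty.\<close>
    also have "\<dots> = ((\<Sum>X\<in>Pow {..<n}. \<chi>' {} X * \<chi>' {} X) - (\<Sum>X\<in>Pow {..<n}. \<chi>' (A i) X * \<chi>' {} X)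
        - (\<Sum>X\<in>Pow {..<n}. \<chi>' (A j) X * \<chi>' {} X) + (\<Sum>X\<in>Pow {..<n}. \<chi>' (A i) X * \<chi>' (A j) X)) / 4"
      unfolding sum_divide_distrib sum_subtractf[symmetric] sum.distrib[symmetric]
      by (intro sum.cong) (simp_all add: \<chi>'_def[of "{}"] algebra_simps)
    also have "\<dots> = 2 ^ n / 4 * (if i = j then 2 else 1)"
      by (simp add: orth A_props A_inj)
    finally show ?thesis .
  qed
  then show ?thesis
    by (simp only: code_matrix_def matrix_matrix_mult_def vec_lambda_beta vec_eq_iff simp_thms)
qed

text \<open>The square suffices, since volumes see only the absolute value of the
  determinant.\<close>

lemma det_code_matrix: "(det code_matrix)\<^sup>2 = (2 ^ n / 4) ^ CARD('d) * 2 ^ n"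
proof -
  have eq: "(\<chi> i j. 2 ^ n / 4 * (if i = j then 2 else 1)) =
      ((\<chi> i. (2 ^ n / 4) *s (\<chi> j. if i = j then 2 else 1)) :: real^'d^'d)"
    by (simp add: vec_eq_iff)
  have "(det code_matrix)\<^sup>2 = det (code_matrix ** code_matrix)"
    by (simp add: det_mul power2_eq_square)
  also have "\<dots> = det ((\<chi> i. (2 ^ n / 4) *s (\<chi> j. if i = j then 2 else 1)) :: real^'d^'d)"
    unfolding code_matrix_square eq ..
  also have "\<dots> = (2 ^ n / 4) ^ CARD('d) * (real CARD('d) + 1)"
    by (subst det_rows_mul) (simp add: det_mat_1_plus_ones)
  finally show ?thesis
    by (simp add: card_eq)
qed

text \<open>Off the diagonal, nonzero entries lie in singleton columns and non-singleton rows, so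
  the diagonal product decides: one factor 2 for each of the \<open>CARD('d) - n\<close>
  non-singletons.\<close>

lemma det_code_basis: "det code_basis = 2 ^ CARD('d) / 2 ^ n"
proof -
  have "det code_basis = (\<Prod>i\<in>UNIV. code_basis $ i $ i)"
  proof (rule det_eq_prod_diag[where S = "{j. card (A j) = 1}"])
    fix i j assume "i \<noteq> j" "code_basis $ i $ j \<noteq> 0"
    then have "card (A j) = 1" "A j \<subseteq> A i"
      by (auto simp: code_basis_def split: if_splits)
    moreover have "card (A i) \<noteq> 1"
      using \<open>i \<noteq> j\<close> \<open>A j \<subseteq> A i\<close> \<open>card (A j) = 1\<close> by (metis A_inj A_props(3) card_subset_eq)
    ultimately show "i \<notin> {j. card (A j) = 1} \<and> j \<in> {j. card (A j) = 1}"
      by simp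
  qed
  also have "\<dots> = (\<Prod>i\<in>UNIV. if i \<in> {j. card (A j) = 1} then 1 else 2)"
    by (intro prod.cong) (auto simp: code_basis_def)
  also have "\<dots> = 2 ^ card (- {j. card (A j) = 1})"
    by (subst prod.If_cases) auto
  also have "card (- {j. card (A j) = 1}) = CARD('d) - n"
  proof -
    have "card {j. card (A j) = 1} = card (singleton_index ` {..<n})"
      using singleton_index_image[of "{..<n}"] A_props(1) by (simp add: lessThan_def)
    then show ?thesis
      by (simp add: Compl_eq_Diff_UNIV card_Diff_subset card_image singleton_index_inj)
  qed
  also have "(2 :: real) ^ (CARD('d) - n) = 2 ^ CARD('d) / 2 ^ n"
  proof (rule power_diff)
    have "n \<le> CARD('d)"
      using card_image[OF singleton_index_inj] card_mono[of UNIV "singleton_index ` {..<n}"] by simp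
    then show "n \<le> CARD('d)" .
  qed simp
  finally show ?thesis .
qed

text \<open>For integer \<open>z\<close>, the coordinates at singletons are free and fix every other
  coordinate up to an even integer, which is how an information set should act.\<close>

lemma code_basis_mult:
  "(code_basis *v z) $ i = (\<Sum>k\<in>A i. z $ singleton_index k) + (if card (A i) = 1 then 0 else 2 * z $ i)"
proof -
  have "(\<Sum>k\<in>A i. z $ singleton_index k) = (\<Sum>j\<in>singleton_index ` A i. z $ j)"
    using inj_on_subset[OF singleton_index_inj A_props(1)] by (simp add: sum.reindex)
  also have "singleton_index ` A i = {j. card (A j) = 1 \<and> A j \<subseteq> A i}"
  proof -
    have "{k \<in> A i. k < n} = A i"
      using A_props(1)[of i] by auto
    then show ?thesis
      using singleton_index_image[of "A i"] by simp
  qed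
  also have "(\<Sum>j\<in>\<dots>. z $ j) = (\<Sum>j\<in>UNIV. if card (A j) = 1 \<and> A j \<subseteq> A i then z $ j else 0)"
    by (simp add: sum.If_cases)
  finally have *: "(\<Sum>k\<in>A i. z $ singleton_index k) =
      (\<Sum>j\<in>UNIV. if card (A j) = 1 \<and> A j \<subseteq> A i then z $ j else 0)" .
  have "(code_basis *v z) $ i = (\<Sum>j\<in>UNIV. (if card (A j) = 1 \<and> A j \<subseteq> A i then z $ j else 0) +
      (if j = i then if card (A i) = 1 then 0 else 2 * z $ i else 0))"
    unfolding matrix_vector_mult_def vec_lambda_beta by (intro sum.cong) (auto simp: code_basis_def)
  then show ?thesis
    by (simp add: sum.distrib *)
qed

lemma code_lattice_basis: "lattice_basis code_lattice code_basis"
  unfolding lattice_basis_def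
proof (intro conjI equalityI subsetI)
  show "invertible code_basis"
    by (simp add: invertible_det_nz det_code_basis)
next
  fix x assume "x \<in> code_lattice"
  then obtain u T where x: "x = (\<chi> i. real_of_int (u i))" and T: "T \<subseteq> {..<n}"
    and u: "\<And>i. odd (u i) \<longleftrightarrow> odd (card (T \<inter> A i))"
    by (auto simp: code_lattice_def)
  define s where "s = (\<lambda>i. \<Sum>k\<in>A i. u (singleton_index k))"
  \<comment> \<open>Solves the triangular system: singleton coordinates are read off, and the rest
    is half of a remainder shown to be even below.\<close>
  define v where "v = (\<lambda>i. if card (A i) = 1 then u i else (u i - s i) div 2)"
  have odd_u: "odd (u (singleton_index k)) \<longleftrightarrow> k \<in> T" if "k < n" for k
    using that by (cases "k \<in> T") (simp_all add: u A_singleton_index)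
  have v_s: "v (singleton_index k) = u (singleton_index k)" if "k < n" for k
    using that by (simp add: v_def A_singleton_index)
  have "(code_basis *v (\<chi> i. of_int (v i))) $ i = of_int (u i)" for i
  proof -
    have "(\<Sum>k\<in>A i. real_of_int (v (singleton_index k))) = of_int (s i)"
      unfolding s_def of_int_sum using A_props(1)[of i] by (intro sum.cong) (auto simp: v_s)
    moreover have "s i = u i" if one: "card (A i) = 1"
    proof -
      obtain k where k: "A i = {k}" "k < n"
        using one A_props(1)[of i] by (auto simp: card_1_singleton_iff)
      then have "singleton_index k = i"
        using A_singleton_index A_inj by metis
      then show ?thesis
        by (simp add: s_def k)
    qed
    moreover have "even (u i - s i)"
    proof -
      have "{k \<in> A i. odd (u (singleton_index k))} = T \<inter> A i"
        using A_props(1)[of i] odd_u by auto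
      then have "even (s i) \<longleftrightarrow> even (card (T \<inter> A i))"
        unfolding s_def using even_sum_iff[OF A_props(3)[of i], of "\<lambda>k. u (singleton_index k)"] by simp
      then show ?thesis
        using u by simp
    qed
    then have "2 * ((u i - s i) div 2) = u i - s i"
      by simp
    then have "2 * real_of_int ((u i - s i) div 2) = real_of_int (u i) - real_of_int (s i)"
      by (metis of_int_diff of_int_mult of_int_numeral)
    ultimately show ?thesis
      by (simp add: code_basis_mult v_def)
  qed
  then have "x = code_basis *v (\<chi> i. of_int (v i))"
    by (simp add: x vec_eq_iff)
  then show "x \<in> {code_basis *v z | z. \<forall>i. z $ i \<in> \<int>}"
    by auto
next
  fix x assume "x \<in> {code_basis *v z | z. \<forall>i. z $ i \<in> \<int>}"
  then obtain z where x: "x = code_basis *v z" and "\<forall>i. \<exists>v. z $ i = real_of_int v"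
    by (auto elim!: Ints_cases) (metis Ints_cases)
  then obtain v where z: "\<And>i. z $ i = real_of_int (v i)"
    by metis
  define u where "u = (\<lambda>i. (\<Sum>k\<in>A i. v (singleton_index k)) + (if card (A i) = 1 then 0 else 2 * v i))"
  \<comment> \<open>The word is read off from the parities on the information set.\<close>
  define T where "T = {k. k < n \<and> odd (v (singleton_index k))}"
  have "odd (u i) \<longleftrightarrow> odd (card (T \<inter> A i))" for i
  proof -
    have "{k \<in> A i. odd (v (singleton_index k))} = T \<inter> A i"
      using A_props(1)[of i] by (auto simp: T_def)
    then show ?thesis
      unfolding u_def using even_sum_iff[OF A_props(3)[of i], of "\<lambda>k. v (singleton_index k)"] by simp
  qed
  moreover have "T \<subseteq> {..<n}"
    by (auto simp: T_def)
  moreover have "x = (\<chi> i. real_of_int (u i))"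
    by (simp add: x vec_eq_iff code_basis_mult u_def z)
  ultimately show "x \<in> code_lattice"
    unfolding code_lattice_def by blast
qed

section \<open>The Delone simplex of the code and its relative volume\<close>

lemma euclidean_lattice_code_lattice: "euclidean_lattice code_lattice"
proof (rule lattice_basis_imp_euclidean_lattice[OF code_lattice_basis])
  show "discrete code_lattice"
  proof (rule discreteI)
    fix x assume x: "x \<in> code_lattice"
    have "1 \<le> dist x y" if y: "y \<in> code_lattice" "y \<noteq> x" for y
    proof -
      obtain u v where uv: "x = (\<chi> i. real_of_int (u i))" "y = (\<chi> i. real_of_int (v i))"
        using x y by (auto simp: code_lattice_def)
      with y(2) have "\<exists>i. u i \<noteq> v i"
        by auto
      then obtain i where "u i \<noteq> v i" ..
      then have "1 \<le> \<bar>real_of_int (u i - v i)\<bar>"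
        by (intro Ints_nonzero_abs_ge1) auto
      also have "\<dots> = \<bar>(x - y) $ i\<bar>"
        by (simp add: uv)
      also have "\<dots> \<le> dist x y"
        unfolding dist_norm by (rule component_le_norm_cart)
      finally show ?thesis .
    qed
    then show "x isolated_in code_lattice"
      using x unfolding isolated_in_dist_Ex_iff by (intro conjI exI[of _ 1]) force+
  qed
qed

text \<open>Affine independence and distinctness of the vertices come from
  \<open>det code_matrix \<noteq> 0\<close>, the empty sphere from the ball around the unit cube.
  The summand \<open>0 +\<close> matches \<open>measure_simplex\<close> with base point 0.\<close>

lemma delone_simplex_code:
  "delone_simplex code_lattice (convex hull (insert 0 ((\<lambda>i. 0 + column i code_matrix) ` UNIV)))"
proof -
  define V where "V = code ` Pow {..<n}"
  \<comment> \<open>Centre and circumradius of the unit cube.\<close>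
  define c :: "real^'d" where "c = (\<chi> i. 1 / 2)"
  define r where "r = sqrt (\<Sum>i\<in>(UNIV :: 'd set). 1 / 4)"
  have code0: "code {} = 0"
    by (simp add: code_def vec_eq_iff)
  have col: "column i code_matrix = code (A i)" for i
    by (simp add: code_matrix_def column_def vec_eq_iff)
  have columns: "columns code_matrix = range (\<lambda>i. code (A i))"
    by (auto simp: columns_def col)
  have "Pow {..<n} = insert {} (range A)"
    using bij by (auto simp: bij_betw_def)
  then have V_eq: "V = insert 0 (columns code_matrix)"
    by (simp add: V_def columns code0 image_image)
  have det: "det code_matrix \<noteq> 0"
    using det_code_matrix by force
  then have ind: "independent (columns code_matrix)"
    using det_dependent_columns[of code_matrix] by (auto simp: dependent_vec_eq)
  have "inj (\<lambda>i. code (A i))"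
    using det det_identical_columns[of _ _ code_matrix] by (auto simp: inj_def col)
  then have card_columns: "card (columns code_matrix) = CARD('d)"
    unfolding columns by (rule card_image)
  have zero: "0 \<notin> columns code_matrix"
    using ind dependent_zero by blast
  have V\<Lambda>: "V \<subseteq> code_lattice"
  proof
    fix v assume "v \<in> V"
    then obtain T where T: "T \<subseteq> {..<n}" "v = code T"
      by (auto simp: V_def)
    then show "v \<in> code_lattice"
      unfolding code_lattice_def code_def
      by (intro CollectI exI[of _ "\<lambda>i. of_bool (odd (card (T \<inter> A i)))"]) (auto simp: vec_eq_iff)
  qed
  have norm: "norm (v - c) = sqrt (\<Sum>i\<in>UNIV. (v $ i - 1 / 2)\<^sup>2)" for v
    by (simp add: norm_vec_def L2_set_def c_def)
  have on: "norm (v - c) = r" if "v \<in> V" for v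
  proof -
    obtain T where "v = code T"
      using \<open>v \<in> V\<close> by (auto simp: V_def)
    then have "(v $ i - 1 / 2)\<^sup>2 = 1 / 4" for i
      by (cases "odd (card (T \<inter> A i))") (simp_all add: code_def power2_eq_square)
    then show ?thesis
      by (simp only: norm r_def)
  qed
  have out: "r < norm (v - c)" if v: "v \<in> code_lattice - V" for v
  proof -
    obtain u T where x: "v = (\<chi> i. real_of_int (u i))" and T: "T \<subseteq> {..<n}"
      and u: "\<And>i. odd (u i) \<longleftrightarrow> odd (card (T \<inter> A i))"
      using v by (auto simp: code_lattice_def)
    \<comment> \<open>The excess \<open>k * (k - 1)\<close> over \<open>1 / 4\<close> is nonnegative
      for integers and zero only at 0 and 1. So an integer vector other than a cube vertex lies
      outside the sphere, and a lattice point that is a cube vertex equals its own parity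
      word.\<close>
    have square: "(real_of_int k - 1 / 2)\<^sup>2 = 1 / 4 + real_of_int (k * (k - 1))" for k
      by (simp add: power2_eq_square algebra_simps)
    have nonneg: "0 \<le> k * (k - 1)" for k :: int
      by (cases "k \<le> 0") (auto simp: zero_le_mult_iff)
    have "\<exists>i. u i \<noteq> 0 \<and> u i \<noteq> 1"
    proof (rule ccontr)
      assume "\<nexists>i. u i \<noteq> 0 \<and> u i \<noteq> 1"
      then have "u i = 0 \<or> u i = 1" for i
        by blast
      then have "real_of_int (u i) = of_bool (odd (card (T \<inter> A i)))" for i
        using u[of i] by (metis even_zero odd_one of_bool_eq of_int_0 of_int_1)
      then have "v = code T"
        by (simp add: x code_def vec_eq_iff)
      then show False
        using v T by (auto simp: V_def)
    qed
    then obtain i where i: "u i \<noteq> 0" "u i \<noteq> 1"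
      by blast
    have "(\<Sum>i\<in>(UNIV :: 'd set). 1 / 4) < (\<Sum>i\<in>UNIV. (v $ i - 1 / 2)\<^sup>2)"
    proof (rule sum_strict_mono_ex1)
      show "\<forall>i\<in>UNIV. 1 / 4 \<le> (v $ i - 1 / 2)\<^sup>2"
        using nonneg by (simp add: x square del: of_int_mult)
      have "0 < u i * (u i - 1)"
        using nonneg[of "u i"] i by (simp add: order.strict_iff_order)
      then have "1 / 4 < (v $ i - 1 / 2)\<^sup>2"
        by (simp add: x square del: of_int_mult)
      then show "\<exists>i\<in>UNIV. 1 / 4 < (v $ i - 1 / 2)\<^sup>2"
        by blast
    qed simp
    then show ?thesis
      by (simp only: norm r_def real_sqrt_less_iff)
  qed
  have "\<not> affine_dependent V"
    unfolding V_eq using affine_dependent_iff_dependent[OF zero] ind by simp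
  moreover have "card V = CARD('d) + 1"
    unfolding V_eq using zero card_columns by (simp add: columns)
  moreover have "r > 0"
    by (simp add: r_def)
  moreover have "insert 0 ((\<lambda>i. 0 + column i code_matrix) ` UNIV) = V"
    by (simp add: V_eq columns col)
  ultimately show ?thesis
    unfolding delone_simplex_def using V\<Lambda> on out
    by (intro exI[of _ V] conjI exI[of _ c] exI[of _ r]) simp_all
qed

text \<open>Both sides are nonnegative, so their squares are compared. Of the \<open>d + 3\<close>
  factors \<open>N\<close>, \<open>det_code_matrix\<close> gives \<open>d + 1\<close> and the
  squared reciprocal of the lattice determinant gives two.\<close>

lemma relative_volume_code:
  "relative_volume code_lattice (convex hull (insert 0 ((\<lambda>i. 0 + column i code_matrix) ` UNIV))) =
    (real CARD('d) + 1) powr ((real CARD('d) + 3) / 2) / 4 ^ CARD('d)"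
  (is "?vol = ?bound")
proof (rule power2_eq_imp_eq)
  define d where "d = CARD('d)"
  define N where "N = (2 :: real) ^ n"
  have N: "real d + 1 = N" "N > 0"
    by (simp_all add: N_def d_def card_eq)
  have vol: "?vol = \<bar>det code_matrix\<bar> * N / 2 ^ d"
    unfolding relative_volume_def measure_simplex lattice_det_eq[OF code_lattice_basis]
    by (simp add: det_code_basis N_def d_def)
  have "?vol\<^sup>2 = (N / 4) ^ d * N * N\<^sup>2 / (2 ^ d)\<^sup>2"
    unfolding vol power_divide power_mult_distrib power2_abs det_code_matrix
    by (simp add: N_def d_def power_divide)
  also have "\<dots> = N ^ (d + 3) / (4 ^ d)\<^sup>2"
  proof -
    have "(2 ^ d :: real)\<^sup>2 = 4 ^ d"
      by (simp add: power2_eq_square flip: power_mult_distrib)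
    then show ?thesis
      by (simp add: power_divide power_add power2_eq_square power3_eq_cube)
  qed
  also have "N ^ (d + 3) = (N powr ((real d + 3) / 2))\<^sup>2"
    using N(2) by (simp add: power2_eq_square flip: powr_add powr_realpow)
  finally show "?vol\<^sup>2 = ?bound\<^sup>2"
    unfolding N(1)[symmetric] by (simp add: d_def power_divide)
  show "0 \<le> ?vol"
    unfolding vol using N(2) by simp
qed simp

end

theorem theorem2:
  fixes n :: nat
  assumes "n > 0"
    and "CARD('d::finite) = 2 ^ n - 1"
  shows "mv TYPE('d) \<ge> (real CARD('d) + 1) powr ((real CARD('d) + 3) / 2) / 4 ^ CARD('d)"
proof -
  have "card (Pow {..<n} - {{}}) = CARD('d)"
    by (simp add: assms(2) card_Diff_subset card_Pow)
  then obtain A :: "'d \<Rightarrow> nat set" where "bij_betw A UNIV (Pow {..<n} - {{}})"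
    using bij_betw_iff_card[of "UNIV :: 'd set" "Pow {..<n} - {{}}"] by auto
  then interpret simplex_code A n
    by unfold_locales
  show ?thesis
    using relative_volume_le_mv[OF euclidean_lattice_code_lattice delone_simplex_code]
    by (simp only: relative_volume_code)
qed

end
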